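(* Let $d\ge 1$ and let $r\ge 1$ be an integer. Let $B$ be a Banach space of functions on $\mathbb{R}^d$ or on $\mathbb{T}^d$ whose norm satisfies, for some $2\le s<\infty$ and some $m>0$, $$\max\big(\|F+G\|_B,\|F-G\|_B\big)\ge \big(\|F\|_B^s+m\|G\|_B^s\big)^{1/s}\quad\text{for all } F,G\in B,$$ and also, for all $f\in B$ and all $\xi,h\in\mathbb{R}^d$, $$\|f(\cdot+\xi)\|_B=\|f(\cdot)\|_B,\qquad \lim_{|h|\to0}\|f(\cdot+h)-f(\cdot)\|_B=0,\qquad \|f(-\,\cdot)\|_B=\|f(\cdot)\|_B .$$ Then there is a constant $C>0$, independent of $f$, $t$ and $n$, such that for all $f\in B$ and all integers $n\ge 1$ $$2^{-nr}\Big\{\sum_{j=1}^n 2^{jrs}\,\omega^{r+1}(f,2^{-j})_B^s\Big\}^{1/s}\le C\,\omega^r(f,2^{-n})_B .$$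
   Context: For $f\in B$, $k\ge1$ and $t>0$, the modulus of smoothness is $\omega^k(f,t)_B=\sup_{|h|\le t}\|\Delta_h^kf\|_B$, where $h\in\mathbb{R}^d$, $\Delta_hf(x)=f(x+h)-f(x)$ and $\Delta_h^{\ell+1}f=\Delta_h(\Delta_h^\ell f)$. The constant $C$ may depend on the space $B$ (with its norm) and on $r$. *)

theory Defs
  imports "HOL-Analysis.Analysis"
begin

text \<open>
  The class \<open>real_normed_field\<close> is used for the values of functions, so that real-valued and
  complex-valued functions are both covered.  Functions on \<open>\<real>\<^sup>d\<close> are arbitrary functions on
  \<open>real^'d\<close>, with \<open>d = CARD('d)\<close>; functions on the torus \<open>\<real>\<^sup>d / (2\<pi>\<int>)\<^sup>d\<close> are identified
  with their periodic lifts.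
\<close>

definition torus_functions :: "(real^'d \<Rightarrow> 'c) set" where
  "torus_functions = {f. \<forall>x i. f (x + (2 * pi) *\<^sub>R axis i 1) = f x}"

text \<open>
  A Banach space of functions, all of them in the ambient class \<open>X\<close> (functions on \<open>\<real>\<^sup>d\<close> or on
  \<open>\<T>\<^sup>d\<close>).  In spaces such as \<open>L\<^sub>p\<close> the elements are really classes of functions, two functions
  being the same element when they agree almost everywhere.  Here the set \<open>B\<close> collects all
  representatives, and \<open>f\<close>, \<open>g\<close> represent the same element of the space iff \<open>N (\<lambda>x. f x - g x) = 0\<close>.
  Hence \<open>N f = 0\<close> is not required to force \<open>f = 0\<close> pointwise; a space of genuine functions is the
  special case in which it does.  Only real scalars are needed: a complex Banach space is in
  particular a real one.
\<close>

locale banach_function_space =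
  fixes X :: "(real^'d \<Rightarrow> 'c::real_normed_field) set"
    and B :: "(real^'d \<Rightarrow> 'c) set"
    and N :: "(real^'d \<Rightarrow> 'c) \<Rightarrow> real"
  assumes subset: "B \<subseteq> X"
    and zero_mem: "(\<lambda>x. 0) \<in> B"
    and add_mem: "\<lbrakk>f \<in> B; g \<in> B\<rbrakk> \<Longrightarrow> (\<lambda>x. f x + g x) \<in> B"
    and scale_mem: "f \<in> B \<Longrightarrow> (\<lambda>x. a *\<^sub>R f x) \<in> B"
    and norm_nonneg: "f \<in> B \<Longrightarrow> 0 \<le> N f"
    and norm_triangle: "\<lbrakk>f \<in> B; g \<in> B\<rbrakk> \<Longrightarrow> N (\<lambda>x. f x + g x) \<le> N f + N g"
    and norm_scale: "f \<in> B \<Longrightarrow> N (\<lambda>x. a *\<^sub>R f x) = \<bar>a\<bar> * N f"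
    and complete:
      "\<lbrakk>\<And>k. F k \<in> B; \<forall>e>0. \<exists>M. \<forall>k\<ge>M. \<forall>l\<ge>M. N (\<lambda>x. F k x - F l x) < e\<rbrakk>
        \<Longrightarrow> \<exists>f\<in>B. (\<lambda>k. N (\<lambda>x. F k x - f x)) \<longlonglongrightarrow> 0"

definition fdiff :: "real^'d \<Rightarrow> (real^'d \<Rightarrow> 'c::real_normed_field) \<Rightarrow> real^'d \<Rightarrow> 'c" where
  "fdiff h f = (\<lambda>x. f (x + h) - f x)"

text \<open>
  When \<open>N\<close> is translation invariant on \<open>B\<close>, \<open>f \<in> B\<close> and \<open>t \<ge> 0\<close>, the supremum is over a nonempty
  set bounded by \<open>2 ^ k * N f\<close>, so it is the true supremum.
\<close>

definition modulus_of_smoothness ::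
    "((real^'d \<Rightarrow> 'c::real_normed_field) \<Rightarrow> real) \<Rightarrow> nat \<Rightarrow> (real^'d \<Rightarrow> 'c) \<Rightarrow> real \<Rightarrow> real" where
  "modulus_of_smoothness N k f t = (SUP h\<in>{h. norm h \<le> t}. N ((fdiff h ^^ k) f))"

end

theory Submission
  imports Defs
begin

text \<open>
  Write \<open>T\<close> for translation by \<open>h\<close>, so that \<open>\<Delta>\<^sub>h = T - 1\<close> and
  \<open>\<Delta>\<^bsub>2h\<^esub> = (T + 1) \<Delta>\<^sub>h\<close>.  With \<open>g = \<Delta>\<^sub>h\<^sup>r f\<close>, the two functions
  \<open>F = 2\<^bsup>-r\<^esup> (T + 1)\<^sup>r g = 2\<^bsup>-r\<^esup> \<Delta>\<^bsub>2h\<^esub>\<^sup>r f\<close> and \<open>G = 2\<^bsup>-r\<^esup> (T - 1) g = 2\<^bsup>-r\<^esup> \<Delta>\<^sub>h\<^bsup>r+1\<^esup> f\<close>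
  have the property that \<open>F + G\<close> and \<open>F - G\<close> are both convex combinations of translates of
  \<open>g\<close>: the coefficients of \<open>(T + 1)\<^sup>r\<close> sum to \<open>2\<^sup>r\<close> and those of \<open>1\<close> and \<open>T\<close> are at least
  \<open>1\<close>, so adding or subtracting \<open>T - 1\<close> keeps all of them nonnegative and keeps the sum.  Hence
  both have norm at most \<open>N g\<close>, and the convexity inequality of the norm yields
  (lemma \<open>fdiff_doubling\<close>)
  \<open>N (\<Delta>\<^bsub>2h\<^esub>\<^sup>r f)\<^sup>s + m N (\<Delta>\<^sub>h\<^bsup>r+1\<^esup> f)\<^sup>s \<le> 2\<^bsup>rs\<^esup> N (\<Delta>\<^sub>h\<^sup>r f)\<^sup>s\<close>.
  Iterating this over \<open>h = 2\<^bsup>-1\<^esup> u, \<dots>, 2\<^bsup>-n\<^esup> u\<close> bounds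
  \<open>\<Sum>\<^sub>j 2\<^bsup>jrs\<^esup> N (\<Delta>\<^bsup>r+1\<^esup> f)\<^sup>s\<close>, with the steps \<open>2\<^bsup>-j\<^esup> u\<close> for one fixed
  vector \<open>u\<close>, by a multiple of \<open>2\<^bsup>nrs\<^esup> \<omega>\<^sup>r(f, 2\<^bsup>-n\<^esup>)\<^sup>s\<close> (lemma \<open>sum_fdiff_dyadic_le\<close>).

  The theorem has moduli of smoothness in the sum, so that the step is allowed to depend on
  \<open>j\<close>.  The gap is closed by averaging over \<open>u\<close>: a change-of-step identity expresses
  \<open>\<Delta>\<^sub>h\<^sup>k f\<close> through differences with the steps \<open>l v\<close> and \<open>h + l v\<close>, \<open>1 \<le> l \<le> k\<close>, where \<open>v\<close> is
  arbitrary (lemma \<open>fdiff_step_change\<close>), and integrating over \<open>v\<close> in a small ball bounds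
  \<open>\<omega>\<^sup>k(f, t)\<^sup>s\<close> by the integral of \<open>N (\<Delta>\<^bsub>tu\<^esub>\<^sup>k f)\<^sup>s\<close> over \<open>norm u \<le> 2\<close>
  (lemma \<open>norm_funpow_fdiff_powr_le_average\<close>).  Since the domain of integration is the same for
  every \<open>t = 2\<^bsup>-j\<^esup>\<close>, sum and integral may be exchanged, and the bound for fixed \<open>u\<close> applies under
  the integral.
\<close>

section \<open>Differences as combinations of translates\<close>

lemma funpow_comp_commute:
  assumes "A \<circ> D = D \<circ> A"
  shows "(A \<circ> D) ^^ n = (A ^^ n) \<circ> (D ^^ n)"
proof (induction n)
  case (Suc n)
  have comm: "D \<circ> (A ^^ j) = (A ^^ j) \<circ> D" for j
  proof (induction j)
    case (Suc j)
    have "D \<circ> (A ^^ Suc j) = (D \<circ> A) \<circ> (A ^^ j)" by (simp add: comp_assoc)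
    also have "\<dots> = A \<circ> (D \<circ> (A ^^ j))" by (simp add: assms[symmetric] comp_assoc)
    also have "\<dots> = (A ^^ Suc j) \<circ> D" by (simp only: Suc comp_assoc funpow.simps)
    finally show ?case .
  qed simp
  have "(A \<circ> D) ^^ Suc n = A \<circ> (D \<circ> (A ^^ n)) \<circ> (D ^^ n)"
    by (simp only: Suc comp_assoc funpow.simps)
  also have "\<dots> = (A ^^ Suc n) \<circ> (D ^^ Suc n)"
    by (simp only: comm comp_assoc funpow.simps)
  finally show ?case .
qed simp

lemma funpow_translate_binomial:
  fixes f :: "'a::real_vector \<Rightarrow> 'b::real_vector" and a :: real
  shows "((\<lambda>f x. f (x + h) + a *\<^sub>R f x) ^^ k) f
    = (\<lambda>x. \<Sum>i\<le>k. (real (k choose i) * a ^ (k - i)) *\<^sub>R f (x + real i *\<^sub>R h))"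
proof (induction k)
  case (Suc k)
  let ?c = "\<lambda>k i. real (k choose i) * a ^ (k - i)"
  have "(\<Sum>i\<le>k. ?c k i *\<^sub>R f (x + h + real i *\<^sub>R h)) + a *\<^sub>R (\<Sum>i\<le>k. ?c k i *\<^sub>R f (x + real i *\<^sub>R h))
      = (\<Sum>i\<le>Suc k. ?c (Suc k) i *\<^sub>R f (x + real i *\<^sub>R h))" (is "?L = ?R") for x
  proof -
    have shift: "x + h + real i *\<^sub>R h = x + real (Suc i) *\<^sub>R h" for i
      by (simp add: algebra_simps)
    have low: "a *\<^sub>R (\<Sum>i\<le>k. ?c k i *\<^sub>R f (x + real i *\<^sub>R h))
        = (\<Sum>i\<le>Suc k. (real (k choose i) * a ^ (Suc k - i)) *\<^sub>R f (x + real i *\<^sub>R h))"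
      by (simp add: scaleR_sum_right Suc_diff_le mult_ac)
    show ?thesis
      unfolding low shift sum.atMost_Suc_shift[of _ k]
      by (simp add: sum.distrib scaleR_add_left distrib_right add_ac)
  qed
  then show ?case by (simp only: funpow.simps o_apply Suc)
qed simp

lemma funpow_fdiff_binomial:
  "(fdiff h ^^ k) f = (\<lambda>x. \<Sum>i\<le>k. (real (k choose i) * (-1) ^ (k - i)) *\<^sub>R f (x + real i *\<^sub>R h))"
proof -
  have *: "fdiff h = (\<lambda>f x. f (x + h) + (-1) *\<^sub>R f x)" by (simp add: fdiff_def fun_eq_iff)
  show ?thesis unfolding * by (rule funpow_translate_binomial)
qed

text \<open>
  Doubling the step: since \<open>T\<^sup>2 - 1 = (T + 1)(T - 1)\<close>, the difference with step \<open>2h\<close> is a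
  combination of translates of the one with step \<open>h\<close>, with positive coefficients.
\<close>

lemma funpow_fdiff_double:
  "(fdiff (2 *\<^sub>R h) ^^ r) f
    = (\<lambda>x. \<Sum>i\<le>r. real (r choose i) *\<^sub>R (fdiff h ^^ r) f (x + real i *\<^sub>R h))"
proof -
  let ?A = "\<lambda>(f :: real^'a \<Rightarrow> 'b) x. f (x + h) + 1 *\<^sub>R f x"
  have double: "fdiff (2 *\<^sub>R h) = ?A \<circ> fdiff h" and comm: "?A \<circ> fdiff h = fdiff h \<circ> ?A"
    by (simp_all add: fdiff_def fun_eq_iff scaleR_2 add.assoc)
  have "(fdiff (2 *\<^sub>R h) ^^ r) f = (?A ^^ r) ((fdiff h ^^ r) f)"
    unfolding double funpow_comp_commute[OF comm] o_apply ..
  then show ?thesis by (simp only: funpow_translate_binomial power_one mult_1_right)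
qed

text \<open>
  In the sum over \<open>0 \<le> l \<le> k\<close> of the same terms, expanding the outer differences produces the values
  of \<open>f\<close> at \<open>x + l h + i l v\<close> and at \<open>x + i h + i l v\<close> with one and the same coefficient, which is
  symmetric in \<open>i\<close> and \<open>l\<close>.  Hence the full sum vanishes, and its term \<open>l = 0\<close> is
  \<open>\<Delta>\<^sub>0\<^sup>k f - \<Delta>\<^sub>h\<^sup>k f\<close> with \<open>\<Delta>\<^sub>0\<^sup>k f = 0\<close>.
\<close>

lemma fdiff_step_change:
  fixes f :: "real^'d \<Rightarrow> 'c::real_normed_field"
  assumes "1 \<le> k"
  shows "(fdiff h ^^ k) f x = (\<Sum>l=1..k. (real (k choose l) * (-1) ^ l) *\<^sub>R
    ((fdiff (real l *\<^sub>R v) ^^ k) f (x + real l *\<^sub>R h) - (fdiff (h + real l *\<^sub>R v) ^^ k) f x))"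
proof -
  let ?T = "\<lambda>l. (real (k choose l) * (-1) ^ l) *\<^sub>R
    ((fdiff (real l *\<^sub>R v) ^^ k) f (x + real l *\<^sub>R h) - (fdiff (h + real l *\<^sub>R v) ^^ k) f x)"
  let ?a = "\<lambda>l i. (real (k choose l) * (-1) ^ l * (real (k choose i) * (-1) ^ (k - i)))"
  let ?g = "\<lambda>l i. f (x + real l *\<^sub>R h + real (i * l) *\<^sub>R v)"
  have sym: "?a l i = ?a i l" if "l \<le> k" "i \<le> k" for l i
  proof -
    have "(-1::real) ^ l * (-1) ^ (k - i) = (-1) ^ i * (-1) ^ (k - l)"
      using that by (simp add: power_add[symmetric] minus_one_power_iff)
    then show ?thesis by (simp add: algebra_simps)
  qed
  have "?T l = (\<Sum>i\<le>k. ?a l i *\<^sub>R ?g l i) - (\<Sum>i\<le>k. ?a l i *\<^sub>R ?g i l)" for l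
    by (simp add: funpow_fdiff_binomial scaleR_diff_right scaleR_sum_right scaleR_add_right
        add.assoc mult_ac)
  then have "(\<Sum>l\<le>k. ?T l)
      = (\<Sum>l\<le>k. \<Sum>i\<le>k. ?a l i *\<^sub>R ?g l i) - (\<Sum>l\<le>k. \<Sum>i\<le>k. ?a l i *\<^sub>R ?g i l)"
    by (simp only: sum_subtractf)
  also have "(\<Sum>l\<le>k. \<Sum>i\<le>k. ?a l i *\<^sub>R ?g i l) = (\<Sum>l\<le>k. \<Sum>i\<le>k. ?a l i *\<^sub>R ?g l i)"
    by (subst sum.swap) (intro sum.cong refl arg_cong2[of _ _ _ _ scaleR] sym, auto)
  finally have "(\<Sum>l\<le>k. ?T l) = 0" by simp
  moreover have "{..k} = insert 0 {1..k}" by auto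
  moreover have "(fdiff 0 ^^ k) f = (\<lambda>x. 0)"
    using assms by (cases k) (auto simp: fdiff_def)
  ultimately show ?thesis by simp
qed

section \<open>Integrals over dilated and shifted arguments\<close>

lemma nn_integral_affine_le:
  fixes J :: "'a::euclidean_space \<Rightarrow> ennreal"
  assumes [measurable]: "J \<in> borel_measurable borel" and c: "1 \<le> c"
  shows "(\<integral>\<^sup>+x. J (t + c *\<^sub>R x) \<partial>lborel) \<le> (\<integral>\<^sup>+x. J x \<partial>lborel)"
proof -
  have "(\<integral>\<^sup>+x. 1 * J (t + c *\<^sub>R x) \<partial>lborel) \<le> (\<integral>\<^sup>+x. ennreal (\<bar>c\<bar> ^ DIM('a)) * J (t + c *\<^sub>R x) \<partial>lborel)"
    using c by (intro nn_integral_mono mult_right_mono) auto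
  also have "\<dots> = (\<integral>\<^sup>+x. J x \<partial>lborel)"
    using c by (subst (2) lborel_affine[of c t]) (auto simp: nn_integral_density nn_integral_distr)
  finally show ?thesis by simp
qed

section \<open>Spaces with a continuous translation-invariant norm\<close>

locale translation_invariant_space =
  banach_function_space X B N for X B :: "(real^'d \<Rightarrow> 'c::real_normed_field) set" and N +
  assumes translate_mem: "f \<in> B \<Longrightarrow> (\<lambda>x. f (x + \<xi>)) \<in> B"
    and norm_translate: "f \<in> B \<Longrightarrow> N (\<lambda>x. f (x + \<xi>)) = N f"
    and norm_translate_tendsto: "f \<in> B \<Longrightarrow> ((\<lambda>h. N (\<lambda>x. f (x + h) - f x)) \<longlongrightarrow> 0) (at 0)"
begin

lemma norm_zero: "N (\<lambda>x. 0) = 0"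
  using norm_scale[OF zero_mem, of 0] by simp

lemma combination_mem_norm_le:
  assumes "\<And>i. i \<in> I \<Longrightarrow> F i \<in> B"
  shows "(\<lambda>x. \<Sum>i\<in>I. c i *\<^sub>R F i x) \<in> B \<and> N (\<lambda>x. \<Sum>i\<in>I. c i *\<^sub>R F i x) \<le> (\<Sum>i\<in>I. \<bar>c i\<bar> * N (F i))"
  using assms
proof (induction I rule: infinite_finite_induct)
  case (insert i I)
  then have *: "(\<lambda>x. \<Sum>i\<in>I. c i *\<^sub>R F i x) \<in> B" "F i \<in> B"
     "N (\<lambda>x. \<Sum>i\<in>I. c i *\<^sub>R F i x) \<le> (\<Sum>i\<in>I. \<bar>c i\<bar> * N (F i))" by auto
  show ?case
    using add_mem[OF scale_mem[OF *(2), of "c i"] *(1)]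
      norm_triangle[OF scale_mem[OF *(2), of "c i"] *(1)] * insert.hyps
    by (simp add: norm_scale)
qed (auto simp: zero_mem norm_zero)

lemma diff_mem_norm_le:
  assumes "f \<in> B" "g \<in> B"
  shows "(\<lambda>x. f x - g x) \<in> B" "N (\<lambda>x. f x - g x) \<le> N f + N g"
  using add_mem[OF assms(1) scale_mem[OF assms(2), of "-1"]]
    norm_triangle[OF assms(1) scale_mem[OF assms(2), of "-1"]] norm_scale[OF assms(2), of "-1"]
  by auto

lemma funpow_fdiff_mem: "f \<in> B \<Longrightarrow> (fdiff h ^^ k) f \<in> B"
  by (induction k) (auto simp: fdiff_def intro: diff_mem_norm_le translate_mem)

lemma norm_funpow_fdiff_nonneg: "f \<in> B \<Longrightarrow> 0 \<le> N ((fdiff h ^^ k) f)"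
  by (simp add: norm_nonneg funpow_fdiff_mem)

lemma norm_funpow_fdiff_le: "f \<in> B \<Longrightarrow> N ((fdiff h ^^ k) f) \<le> 2 ^ k * N f"
proof (induction k)
  case (Suc k)
  let ?g = "(fdiff h ^^ k) f"
  have g: "?g \<in> B" using Suc by (simp add: funpow_fdiff_mem)
  have "N ((fdiff h ^^ Suc k) f) \<le> N (\<lambda>x. ?g (x + h)) + N ?g"
    using diff_mem_norm_le(2)[OF translate_mem[OF g] g] by (simp add: fdiff_def)
  then show ?case using Suc norm_translate[OF g] by simp
qed simp

lemma norm_funpow_fdiff_le_modulus:
  assumes "f \<in> B" "norm h \<le> t"
  shows "N ((fdiff h ^^ k) f) \<le> modulus_of_smoothness N k f t"
  unfolding modulus_of_smoothness_def
  by (rule cSUP_upper) (use assms norm_funpow_fdiff_le in \<open>auto intro!: bdd_aboveI2\<close>)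

lemma modulus_le:
  assumes "0 \<le> t" "\<And>h. norm h \<le> t \<Longrightarrow> N ((fdiff h ^^ k) f) \<le> b"
  shows "modulus_of_smoothness N k f t \<le> b"
  unfolding modulus_of_smoothness_def
  by (rule cSUP_least) (use assms in \<open>auto intro!: exI[of _ 0]\<close>)

lemma modulus_nonneg:
  assumes "f \<in> B" "0 \<le> t"
  shows "0 \<le> modulus_of_smoothness N k f t"
  using norm_funpow_fdiff_le_modulus[of f 0 t k] norm_funpow_fdiff_nonneg[of f k 0] assms by auto

lemma norm_diff_abs_le:
  assumes "f \<in> B" "g \<in> B"
  shows "\<bar>N f - N g\<bar> \<le> N (\<lambda>x. f x - g x)"
proof -
  have d: "(\<lambda>x. f x - g x) \<in> B" "(\<lambda>x. g x - f x) \<in> B" using assms by (auto intro: diff_mem_norm_le)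
  have "N (\<lambda>x. g x - f x) = N (\<lambda>x. f x - g x)"
    using norm_scale[OF d(1), of "-1"] by simp
  then show ?thesis
    using norm_triangle[OF d(1) assms(2)] norm_triangle[OF d(2) assms(1)] by auto
qed

text \<open>
  This makes powers of \<open>N (\<Delta>\<^sub>h\<^sup>k f)\<close> integrable over balls.  Up to a translation, the \<open>i\<close>-th
  term of the binomial expansion changes by \<open>f(\<cdot> + i (h - u)) - f\<close> when \<open>u\<close> is replaced by \<open>h\<close>.
\<close>

lemma continuous_norm_funpow_fdiff:
  assumes f: "f \<in> B"
  shows "continuous_on UNIV (\<lambda>h. N ((fdiff h ^^ k) f))"
proof -
  have "((\<lambda>h. N ((fdiff h ^^ k) f)) \<longlongrightarrow> N ((fdiff u ^^ k) f)) (at u)" for u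
  proof -
    let ?c = "\<lambda>i. real (k choose i) * (-1) ^ (k - i)"
    let ?E = "\<lambda>i h x. f (x + real i *\<^sub>R h) - f (x + real i *\<^sub>R u)"
    have E_mem: "?E i h \<in> B" for i h
      by (intro diff_mem_norm_le translate_mem f)
    have E_norm: "N (?E i h) = N (\<lambda>x. f (x + real i *\<^sub>R (h - u)) - f x)" for i h
    proof -
      have *: "(\<lambda>x. f (x + real i *\<^sub>R (h - u)) - f x) \<in> B"
        by (intro diff_mem_norm_le translate_mem f)
      show ?thesis using norm_translate[OF *, of "real i *\<^sub>R u"] by (simp add: algebra_simps)
    qed
    have cont: "isCont (\<lambda>h. N (\<lambda>x. f (x + h) - f x)) 0"
      using norm_translate_tendsto[OF f] by (simp add: isCont_def norm_zero)
    have "isCont (\<lambda>h. N (?E i h)) u" for i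
    proof -
      have "isCont (\<lambda>h. real i *\<^sub>R (h - u)) u" by (intro continuous_intros)
      then show ?thesis
        unfolding E_norm by (rule isCont_o2) (simp add: cont)
    qed
    then have lim: "((\<lambda>h. N (?E i h)) \<longlongrightarrow> 0) (at u)" for i
      by (simp add: isCont_def norm_zero)
    have "((\<lambda>h. \<Sum>i\<le>k. \<bar>?c i\<bar> * N (?E i h)) \<longlongrightarrow> (\<Sum>i\<le>k. \<bar>?c i\<bar> * 0)) (at u)"
      by (intro tendsto_intros lim)
    then have "((\<lambda>h. \<Sum>i\<le>k. \<bar>?c i\<bar> * N (?E i h)) \<longlongrightarrow> 0) (at u)" by simp
    moreover have "norm (N ((fdiff h ^^ k) f) - N ((fdiff u ^^ k) f)) \<le> (\<Sum>i\<le>k. \<bar>?c i\<bar> * N (?E i h))" for h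
    proof -
      have "(\<lambda>x. (fdiff h ^^ k) f x - (fdiff u ^^ k) f x) = (\<lambda>x. \<Sum>i\<le>k. ?c i *\<^sub>R ?E i h x)"
        by (simp add: funpow_fdiff_binomial sum_subtractf scaleR_diff_right)
      then show ?thesis
        using norm_diff_abs_le[OF funpow_fdiff_mem[OF f, of k h] funpow_fdiff_mem[OF f, of k u]]
          combination_mem_norm_le[of "{..k}" "\<lambda>i. ?E i h" ?c] E_mem by auto
    qed
    ultimately have "((\<lambda>h. N ((fdiff h ^^ k) f) - N ((fdiff u ^^ k) f)) \<longlongrightarrow> 0) (at u)"
      by (intro Lim_null_comparison[of "\<lambda>h. N ((fdiff h ^^ k) f) - N ((fdiff u ^^ k) f)"]) (auto intro: always_eventually)
    then show ?thesis by (rule LIM_zero_cancel)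
  qed
  then show ?thesis by (simp add: continuous_on_def)
qed

lemma continuous_on_norm_funpow_fdiff_powr:
  assumes "f \<in> B" "0 < s"
  shows "continuous_on A (\<lambda>u. N ((fdiff (t *\<^sub>R u) ^^ k) f) powr s)"
proof -
  have "continuous_on A (\<lambda>u. N ((fdiff (t *\<^sub>R u) ^^ k) f))"
    by (rule continuous_on_compose2[OF continuous_norm_funpow_fdiff[OF assms(1)]])
      (auto intro: continuous_intros)
  then show ?thesis
    using assms by (intro continuous_on_powr') (auto simp: norm_funpow_fdiff_nonneg)
qed

section \<open>A modulus of smoothness is controlled by an average\<close>

lemma norm_funpow_fdiff_step_change:
  assumes f: "f \<in> B" and k: "1 \<le> k"
  shows "N ((fdiff h ^^ k) f) \<le> (\<Sum>l=1..k. real (k choose l) *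
    (N ((fdiff (real l *\<^sub>R v) ^^ k) f) + N ((fdiff (h + real l *\<^sub>R v) ^^ k) f)))"
proof -
  let ?F = "\<lambda>l x. (fdiff (real l *\<^sub>R v) ^^ k) f (x + real l *\<^sub>R h) - (fdiff (h + real l *\<^sub>R v) ^^ k) f x"
  have F: "?F l \<in> B"
    "N (?F l) \<le> N ((fdiff (real l *\<^sub>R v) ^^ k) f) + N ((fdiff (h + real l *\<^sub>R v) ^^ k) f)" for l
    using diff_mem_norm_le[OF translate_mem[OF funpow_fdiff_mem[OF f]] funpow_fdiff_mem[OF f],
        of k "real l *\<^sub>R v" "real l *\<^sub>R h" k "h + real l *\<^sub>R v"]
    by (auto simp: norm_translate funpow_fdiff_mem f)
  have "(fdiff h ^^ k) f = (\<lambda>x. \<Sum>l=1..k. (real (k choose l) * (-1) ^ l) *\<^sub>R ?F l x)"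
    using fdiff_step_change[OF k] by blast
  then have "N ((fdiff h ^^ k) f) \<le> (\<Sum>l=1..k. \<bar>real (k choose l) * (-1) ^ l\<bar> * N (?F l))"
    using combination_mem_norm_le[of "{1..k}" ?F "\<lambda>l. real (k choose l) * (-1) ^ l"] F(1) by simp
  also have "\<dots> \<le> (\<Sum>l=1..k. real (k choose l) *
    (N ((fdiff (real l *\<^sub>R v) ^^ k) f) + N ((fdiff (h + real l *\<^sub>R v) ^^ k) f)))"
    by (intro sum_mono) (simp add: abs_mult power_abs mult_left_mono F(2))
  finally show ?thesis .
qed

lemma norm_funpow_fdiff_powr_step_change:
  assumes f: "f \<in> B" and k: "1 \<le> k" and s: "0 < s"
  shows "N ((fdiff h ^^ k) f) powr s \<le> (2 ^ (k + 1)) powr s * (\<Sum>l=1..k.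
    N ((fdiff (real l *\<^sub>R v) ^^ k) f) powr s + N ((fdiff (h + real l *\<^sub>R v) ^^ k) f) powr s)"
proof -
  let ?p = "\<lambda>l. N ((fdiff (real l *\<^sub>R v) ^^ k) f)"
  let ?q = "\<lambda>l. N ((fdiff (h + real l *\<^sub>R v) ^^ k) f)"
  define S where "S = (\<Sum>l=1..k. ?p l powr s + ?q l powr s)"
  have S: "0 \<le> S" unfolding S_def by (intro sum_nonneg) simp
  have le: "?p l \<le> S powr (1/s) \<and> ?q l \<le> S powr (1/s)" if "l \<in> {1..k}" for l
  proof -
    have "?p l powr s + ?q l powr s \<le> S"
      unfolding S_def using that by (intro member_le_sum[where f = "\<lambda>l. ?p l powr s + ?q l powr s"]) auto
    then have "?p l powr s \<le> S" "?q l powr s \<le> S"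
      using powr_ge_zero[of "?p l" s] powr_ge_zero[of "?q l" s] by linarith+
    then have "(?p l powr s) powr (1/s) \<le> S powr (1/s)" "(?q l powr s) powr (1/s) \<le> S powr (1/s)"
      using s by (auto intro!: powr_mono2)
    then show ?thesis using s norm_funpow_fdiff_nonneg[OF f] by (simp add: powr_powr)
  qed
  have "N ((fdiff h ^^ k) f) \<le> (\<Sum>l=1..k. real (k choose l) * (?p l + ?q l))"
    by (rule norm_funpow_fdiff_step_change[OF f k])
  also have "\<dots> \<le> (\<Sum>l=1..k. real (k choose l) * (2 * S powr (1/s)))"
    by (intro sum_mono mult_left_mono) (use le in force, simp)
  also have "\<dots> \<le> (\<Sum>l\<le>k. real (k choose l) * (2 * S powr (1/s)))"
    by (intro sum_mono2) auto
  also have "\<dots> = 2 ^ (k + 1) * S powr (1/s)"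
    using choose_row_sum[of k] by (simp add: sum_distrib_right[symmetric] flip: of_nat_sum)
  finally have "N ((fdiff h ^^ k) f) powr s \<le> (2 ^ (k + 1) * S powr (1/s)) powr s"
    using s norm_funpow_fdiff_nonneg[OF f] by (intro powr_mono2) auto
  also have "\<dots> = (2 ^ (k + 1)) powr s * S"
    using s S by (simp add: powr_mult powr_powr)
  finally show ?thesis unfolding S_def .
qed


text \<open>
  The average of the preceding inequality over \<open>v\<close> in the ball \<open>D\<close> of radius \<open>1/k\<close>.  For such \<open>v\<close>,
  \<open>norm h \<le> 1\<close> and \<open>l \<le> k\<close>, the steps \<open>l v\<close> and \<open>h + l v\<close> stay in the ball of radius \<open>2\<close>, and the
  substitution \<open>u = h + l v\<close> or \<open>u = l v\<close> multiplies the volume by \<open>l\<^sup>d \<ge> 1\<close>.  The factor \<open>t\<close> is split off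
  because \<open>K\<close> has to serve all scales at once.
\<close>

lemma norm_funpow_fdiff_powr_le_average:
  assumes k: "1 \<le> k" and s: "0 < s"
  shows "\<exists>K>0. \<forall>f\<in>B. \<forall>t h. norm h \<le> 1 \<longrightarrow>
    N ((fdiff (t *\<^sub>R h) ^^ k) f) powr s
      \<le> K * (LINT u:cball 0 2|lborel. N ((fdiff (t *\<^sub>R u) ^^ k) f) powr s)"
proof -
  define D :: "(real^'d) set" where "D = cball 0 (1 / real k)"
  define c :: real where "c = (2 ^ (k + 1)) powr s"
  define K where "K = c * (real k * 2) / measure lborel D"
  have D_pos: "0 < measure lborel D"
    unfolding D_def by (rule content_cball_pos) (use k in simp)
  have D_fin: "emeasure lborel D = ennreal (measure lborel D)"
    using emeasure_bounded_finite[of D] by (intro emeasure_eq_ennreal_measure) (auto simp: D_def)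
  have "N ((fdiff (t *\<^sub>R h) ^^ k) f) powr s
      \<le> K * (LINT u:cball 0 2|lborel. N ((fdiff (t *\<^sub>R u) ^^ k) f) powr s)"
    if f: "f \<in> B" and h: "norm h \<le> 1" for f t and h :: "real^'d"
  proof -
    define g where "g u = N ((fdiff (t *\<^sub>R u) ^^ k) f) powr s" for u
    define I where "I = (LINT u:cball 0 2|lborel. g u)"
    \<comment> \<open>Extended by zero and with values in \<open>ennreal\<close>, so that the substitutions on the whole space
      need no integrability.\<close>
    define J where "J u = ennreal (indicator (cball 0 2) u *\<^sub>R g u)" for u
    have g_nonneg: "0 \<le> g u" for u by (simp add: g_def)
    have int: "integrable lborel (\<lambda>u. indicator (cball 0 2) u *\<^sub>R g u)"
      unfolding g_def by (intro borel_integrable_compact continuous_on_norm_funpow_fdiff_powr f s) simp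
    have meas: "J \<in> borel_measurable borel"
      using borel_measurable_integrable[OF int] unfolding J_def by simp
    have J_int: "(\<integral>\<^sup>+u. J u \<partial>lborel) = ennreal I"
      unfolding J_def I_def set_lebesgue_integral_def
      by (intro nn_integral_eq_integral int) (simp add: g_nonneg)
    have I: "0 \<le> I"
      unfolding I_def set_lebesgue_integral_def by (intro Bochner_Integration.integral_nonneg) (simp add: g_nonneg)
    have point: "ennreal (g h) * indicator D v
        \<le> ennreal c * (\<Sum>l=1..k. J (0 + real l *\<^sub>R v) + J (h + real l *\<^sub>R v))" for v
    proof (cases "v \<in> D")
      case True
      have "norm (real l *\<^sub>R v) \<le> 1" if "l \<in> {1..k}" for l
      proof -
        have "real l * norm v \<le> real k * (1 / real k)"
          using that True by (intro mult_mono) (auto simp: D_def)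
        then show ?thesis using k by simp
      qed
      then have J: "J (0 + real l *\<^sub>R v) + J (h + real l *\<^sub>R v)
          = ennreal (g (real l *\<^sub>R v) + g (h + real l *\<^sub>R v))" if "l \<in> {1..k}" for l
        using that h norm_triangle_ineq[of h "real l *\<^sub>R v"]
        by (force simp: J_def g_nonneg ennreal_plus)
      have "g h \<le> c * (\<Sum>l=1..k. g (real l *\<^sub>R v) + g (h + real l *\<^sub>R v))"
        using norm_funpow_fdiff_powr_step_change[OF f k s, of "t *\<^sub>R h" "t *\<^sub>R v"]
        by (simp add: g_def c_def scaleR_add_right mult.commute)
      then have "ennreal (g h) \<le> ennreal (c * (\<Sum>l=1..k. g (real l *\<^sub>R v) + g (h + real l *\<^sub>R v)))"
        by (rule ennreal_leI)
      also have "\<dots> = ennreal c * (\<Sum>l=1..k. ennreal (g (real l *\<^sub>R v) + g (h + real l *\<^sub>R v)))"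
        by (subst sum_ennreal) (auto simp: ennreal_mult' c_def g_nonneg)
      also have "\<dots> = ennreal c * (\<Sum>l=1..k. J (0 + real l *\<^sub>R v) + J (h + real l *\<^sub>R v))"
        by (intro arg_cong[where f = "(*) (ennreal c)"] sum.cong refl J[symmetric])
      finally show ?thesis using True by simp
    qed simp
    have "ennreal (g h * measure lborel D) = (\<integral>\<^sup>+v. ennreal (g h) * indicator D v \<partial>lborel)"
      by (subst nn_integral_cmult_indicator) (simp_all add: D_fin ennreal_mult g_nonneg, simp add: D_def)
    also have "\<dots> \<le> (\<integral>\<^sup>+v. ennreal c * (\<Sum>l=1..k. J (0 + real l *\<^sub>R v) + J (h + real l *\<^sub>R v)) \<partial>lborel)"
      by (intro nn_integral_mono point)
    also have "\<dots> = ennreal c * (\<Sum>l=1..k. (\<integral>\<^sup>+v. J (0 + real l *\<^sub>R v) \<partial>lborel)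
        + (\<integral>\<^sup>+v. J (h + real l *\<^sub>R v) \<partial>lborel))"
      using meas by (simp add: nn_integral_cmult nn_integral_sum nn_integral_add)
    also have "\<dots> \<le> ennreal c * (\<Sum>l=1..k. ennreal I + ennreal I)"
      unfolding J_int[symmetric]
      by (intro mult_left_mono sum_mono add_mono nn_integral_affine_le meas) auto
    also have "\<dots> = ennreal (c * (real k * 2) * I)"
      using I by (simp add: ennreal_mult c_def ennreal_plus[symmetric] ennreal_of_nat_eq_real_of_nat
          mult_ac del: ennreal_plus)
    finally have "g h * measure lborel D \<le> c * (real k * 2) * I"
      using I by (subst (asm) ennreal_le_iff) (auto simp: c_def)
    then show ?thesis
      using D_pos unfolding K_def g_def[symmetric] I_def[symmetric] by (simp add: field_simps)
  qed
  moreover have "0 < K" using D_pos k by (simp add: K_def c_def)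
  ultimately show ?thesis by blast
qed

end

section \<open>Norms with a power-type convexity inequality\<close>

locale power_type_space = translation_invariant_space X B N
  for X B :: "(real^'d \<Rightarrow> 'c::real_normed_field) set" and N +
  fixes s m :: real
  assumes s_pos: "0 < s" and m_pos: "0 < m"
    and power_type: "\<lbrakk>F \<in> B; G \<in> B\<rbrakk> \<Longrightarrow>
      (N F powr s + m * N G powr s) powr (1 / s)
        \<le> max (N (\<lambda>x. F x + G x)) (N (\<lambda>x. F x - G x))"
begin

text \<open>
  The convexity inequality is applied to \<open>F = 2\<^bsup>-r\<^esup> \<Delta>\<^bsub>2h\<^esub>\<^sup>r f\<close> and \<open>G = 2\<^bsup>-r\<^esup> \<Delta>\<^sub>h\<^bsup>r+1\<^esup> f\<close>, for which
  \<open>F + G\<close> and \<open>F - G\<close> are convex combinations of translates of \<open>\<Delta>\<^sub>h\<^sup>r f\<close>.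
\<close>

lemma fdiff_doubling:
  assumes f: "f \<in> B" and r: "1 \<le> r"
  shows "N ((fdiff (2 *\<^sub>R h) ^^ r) f) powr s + m * N ((fdiff h ^^ (r + 1)) f) powr s
    \<le> 2 powr (real r * s) * N ((fdiff h ^^ r) f) powr s"
proof -
  let ?g = "(fdiff h ^^ r) f"
  let ?F = "\<lambda>x. (1 / 2 ^ r) *\<^sub>R (fdiff (2 *\<^sub>R h) ^^ r) f x"
  let ?G = "\<lambda>x. (1 / 2 ^ r) *\<^sub>R (fdiff h ^^ (r + 1)) f x"
  \<comment> \<open>The coefficients of \<open>T - 1\<close>.\<close>
  define e :: "nat \<Rightarrow> real" where "e i = (if i = 1 then 1 else 0) - (if i = 0 then 1 else 0)" for i
  have g: "?g \<in> B" by (rule funpow_fdiff_mem[OF f])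
  have combination: "(\<lambda>x. ?F x + \<sigma> *\<^sub>R ?G x)
      = (\<lambda>x. \<Sum>i\<le>r. ((real (r choose i) + \<sigma> * e i) / 2 ^ r) *\<^sub>R ?g (x + real i *\<^sub>R h))" for \<sigma>
  proof
    fix x
    have delta: "e i *\<^sub>R \<phi> = (if i = 1 then \<phi> else 0) - (if i = 0 then \<phi> else 0)" for i and \<phi> :: 'c
      by (simp add: e_def)
    have "(\<Sum>i\<le>r. e i *\<^sub>R ?g (x + real i *\<^sub>R h)) = (fdiff h ^^ (r + 1)) f x"
      unfolding delta sum_subtractf using r by (simp add: sum.delta fdiff_def)
    then have "?F x + \<sigma> *\<^sub>R ?G x
        = (1 / 2 ^ r) *\<^sub>R ((\<Sum>i\<le>r. real (r choose i) *\<^sub>R ?g (x + real i *\<^sub>R h))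
            + \<sigma> *\<^sub>R (\<Sum>i\<le>r. e i *\<^sub>R ?g (x + real i *\<^sub>R h)))"
      by (simp add: funpow_fdiff_double scaleR_add_right mult.commute)
    also have "\<dots> = (\<Sum>i\<le>r. ((real (r choose i) + \<sigma> * e i) / 2 ^ r) *\<^sub>R ?g (x + real i *\<^sub>R h))"
      by (simp add: scaleR_sum_right scaleR_add_right scaleR_add_left sum.distrib add_divide_distrib)
    finally show "?F x + \<sigma> *\<^sub>R ?G x = \<dots>" .
  qed
  \<comment> \<open>Here \<open>r \<ge> 1\<close> matters: \<open>T\<close> occurs in \<open>(T + 1)\<^sup>r\<close> with coefficient \<open>r\<close>, which has to absorb
    the coefficient \<open>1\<close> of \<open>T\<close> in \<open>T - 1\<close>.\<close>
  have bound: "N (\<lambda>x. ?F x + \<sigma> *\<^sub>R ?G x) \<le> N ?g" if \<sigma>: "\<bar>\<sigma>\<bar> = 1" for \<sigma> :: real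
  proof -
    have nonneg: "0 \<le> real (r choose i) + \<sigma> * e i" for i
      using \<sigma> r by (auto simp: e_def abs_if split: if_splits)
    have "(\<Sum>i\<le>r. e i) = 0" unfolding e_def sum_subtractf using r by simp
    then have total: "(\<Sum>i\<le>r. (real (r choose i) + \<sigma> * e i) / 2 ^ r) = 1"
      using choose_row_sum[of r]
      by (simp add: sum_divide_distrib[symmetric] sum.distrib sum_distrib_left[symmetric]
          flip: of_nat_sum)
    have "N (\<lambda>x. ?F x + \<sigma> *\<^sub>R ?G x)
        \<le> (\<Sum>i\<le>r. \<bar>(real (r choose i) + \<sigma> * e i) / 2 ^ r\<bar> * N (\<lambda>x. ?g (x + real i *\<^sub>R h)))"
      unfolding combination using translate_mem[OF g]
      by (intro combination_mem_norm_le[THEN conjunct2])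
    also have "\<dots> = (\<Sum>i\<le>r. (real (r choose i) + \<sigma> * e i) / 2 ^ r * N ?g)"
      using nonneg norm_translate[OF g] by simp
    also have "\<dots> = N ?g" by (simp only: sum_distrib_right[symmetric] total mult_1_left)
    finally show ?thesis .
  qed
  have "(N ?F powr s + m * N ?G powr s) powr (1 / s) \<le> N ?g"
    using power_type[of ?F ?G] bound[of 1] bound[of "-1"] scale_mem funpow_fdiff_mem[OF f]
    by fastforce
  then have "((N ?F powr s + m * N ?G powr s) powr (1 / s)) powr s \<le> N ?g powr s"
    using s_pos by (intro powr_mono2) auto
  then have le: "N ?F powr s + m * N ?G powr s \<le> N ?g powr s"
    using s_pos m_pos by (simp add: powr_powr)
  have scaled: "N (\<lambda>x. (1 / 2 ^ r) *\<^sub>R u x) powr s = N u powr s / 2 powr (real r * s)"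
    if "u \<in> B" for u
    using norm_scale[OF that] norm_nonneg[OF that]
    by (simp add: powr_divide powr_powr flip: powr_realpow)
  show ?thesis
    using le unfolding scaled[OF funpow_fdiff_mem[OF f]]
    by (simp add: field_simps)
qed

text \<open>
  Telescoping: the doubling inequality for the step \<open>2\<^bsup>-j\<^esup> u\<close>, multiplied by \<open>2\<^bsup>jrs\<^esup>\<close>, has on its
  right the first term of its left side for \<open>j + 1\<close>.
\<close>

lemma sum_fdiff_dyadic_le:
  assumes f: "f \<in> B" and r: "1 \<le> r"
  shows "m * (\<Sum>j=1..n. 2 powr (real j * real r * s)
        * N ((fdiff (2 powr (- real j) *\<^sub>R u) ^^ (r + 1)) f) powr s)
      + 2 powr (real r * s) * N ((fdiff u ^^ r) f) powr s
    \<le> 2 powr (real (n + 1) * real r * s) * N ((fdiff (2 powr (- real n) *\<^sub>R u) ^^ r) f) powr s"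
proof (induction n)
  case (Suc n)
  let ?h = "2 powr (- real (Suc n)) *\<^sub>R u"
  let ?p = "2 powr (real (Suc n) * real r * s)"
  have "2 * 2 powr (- real (Suc n)) = (2::real) powr (- real n)"
    using powr_add[of 2 1 "- real (Suc n)"] by simp
  then have "2 *\<^sub>R ?h = 2 powr (- real n) *\<^sub>R u"
    by (simp only: scaleR_scaleR)
  then have "?p * (N ((fdiff (2 powr (- real n) *\<^sub>R u) ^^ r) f) powr s + m * N ((fdiff ?h ^^ (r + 1)) f) powr s)
      \<le> ?p * (2 powr (real r * s) * N ((fdiff ?h ^^ r) f) powr s)"
    using fdiff_doubling[OF f r, of ?h] by (intro mult_left_mono) auto
  also have "\<dots> = 2 powr (real (Suc n + 1) * real r * s) * N ((fdiff ?h ^^ r) f) powr s"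
    by (simp add: powr_add[symmetric] algebra_simps)
  finally show ?case
    using Suc by (simp add: algebra_simps)
qed simp

text \<open>
  Each modulus on the left is replaced by an integral over
  the same ball, and the dyadic sum for a fixed \<open>u\<close> is bounded under the integral.
\<close>

lemma sum_modulus_dyadic_le:
  assumes r: "1 \<le> r"
  shows "\<exists>C>0. \<forall>f\<in>B. \<forall>n. (\<Sum>j=1..n. 2 powr (real j * real r * s)
      * modulus_of_smoothness N (r + 1) f (2 powr (- real j)) powr s)
    \<le> C * 2 powr (real n * real r * s) * modulus_of_smoothness N r f (2 powr (- real n)) powr s"
proof -
  obtain K where K: "0 < K" and average: "\<And>f t h. \<lbrakk>f \<in> B; norm h \<le> 1\<rbrakk> \<Longrightarrow>
      N ((fdiff (t *\<^sub>R h) ^^ (r + 1)) f) powr s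
        \<le> K * (LINT u:cball 0 2|lborel. N ((fdiff (t *\<^sub>R u) ^^ (r + 1)) f) powr s)"
    using norm_funpow_fdiff_powr_le_average[of "r + 1" s] s_pos by auto
  define V where "V = measure lborel (cball 0 2 :: (real^'d) set)"
  define C where "C = K * (2 powr (real r * s) * 2 powr (real r * s) / m) * V"
  have V: "0 < V" unfolding V_def by (rule content_cball_pos) simp
  have "(\<Sum>j=1..n. 2 powr (real j * real r * s)
      * modulus_of_smoothness N (r + 1) f (2 powr (- real j)) powr s)
    \<le> C * 2 powr (real n * real r * s) * modulus_of_smoothness N r f (2 powr (- real n)) powr s"
    if f: "f \<in> B" for f n
  proof -
    define g where "g j u = N ((fdiff (2 powr (- real j) *\<^sub>R u) ^^ (r + 1)) f) powr s" for j u
    define \<omega> where "\<omega> = modulus_of_smoothness N r f (2 powr (- real n))"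
    define M where "M = 2 powr (real n * real r * s)
      * (2 powr (real r * s) * 2 powr (real r * s) / m) * \<omega> powr s"
    have int: "set_integrable lborel (cball 0 2) (g j)" for j
      unfolding g_def set_integrable_def
      by (intro borel_integrable_compact continuous_on_norm_funpow_fdiff_powr f s_pos) simp
    have modulus: "modulus_of_smoothness N (r + 1) f (2 powr (- real j)) powr s
        \<le> K * (LINT u:cball 0 2|lborel. g j u)" for j
    proof -
      let ?I = "LINT u:cball 0 2|lborel. g j u"
      have I: "0 \<le> ?I"
        unfolding set_lebesgue_integral_def by (intro Bochner_Integration.integral_nonneg) (simp add: g_def)
      have "modulus_of_smoothness N (r + 1) f (2 powr (- real j)) \<le> (K * ?I) powr (1 / s)"
      proof (rule modulus_le)
        fix h :: "real^'d" assume "norm h \<le> 2 powr (- real j)"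
        then have "norm (2 powr real j *\<^sub>R h) \<le> 1"
          by (simp add: powr_minus field_simps)
        from average[OF f this, of "2 powr (- real j)"]
        have "N ((fdiff h ^^ (r + 1)) f) powr s \<le> K * ?I"
          by (simp add: g_def powr_minus)
        then have "(N ((fdiff h ^^ (r + 1)) f) powr s) powr (1 / s) \<le> (K * ?I) powr (1 / s)"
          using s_pos by (intro powr_mono2) auto
        then show "N ((fdiff h ^^ (r + 1)) f) \<le> (K * ?I) powr (1 / s)"
          using s_pos norm_funpow_fdiff_nonneg[OF f, of "r + 1" h] by (simp add: powr_powr)
      qed simp
      then have "modulus_of_smoothness N (r + 1) f (2 powr (- real j)) powr s
          \<le> ((K * ?I) powr (1 / s)) powr s"
        using s_pos modulus_nonneg[OF f] by (intro powr_mono2) auto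
      then show ?thesis using s_pos K I by (simp add: powr_powr)
    qed
    have sum_le: "(\<Sum>j=1..n. 2 powr (real j * real r * s) * g j u) \<le> M" if u: "u \<in> cball 0 2" for u
    proof -
      \<comment> \<open>As \<open>norm u\<close> may be \<open>2\<close>, the step \<open>2\<^bsup>-n\<^esup> u\<close> can exceed \<open>2\<^bsup>-n\<^esup>\<close>; one more halving brings it
        into the range of the modulus.\<close>
      let ?h = "2 powr (- real n) *\<^sub>R ((1/2) *\<^sub>R u)"
      have "norm ?h \<le> 2 powr (- real n)" using u by simp
      then have "N ((fdiff ?h ^^ r) f) \<le> \<omega>"
        unfolding \<omega>_def by (rule norm_funpow_fdiff_le_modulus[OF f])
      then have h: "N ((fdiff ?h ^^ r) f) powr s \<le> \<omega> powr s"
        using s_pos norm_funpow_fdiff_nonneg[OF f] by (intro powr_mono2) auto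
      have "N ((fdiff (2 *\<^sub>R ?h) ^^ r) f) powr s
          \<le> N ((fdiff (2 *\<^sub>R ?h) ^^ r) f) powr s + m * N ((fdiff ?h ^^ (r + 1)) f) powr s"
        using m_pos by simp
      also have "\<dots> \<le> 2 powr (real r * s) * N ((fdiff ?h ^^ r) f) powr s"
        by (rule fdiff_doubling[OF f r])
      also have "\<dots> \<le> 2 powr (real r * s) * \<omega> powr s"
        using h by (intro mult_left_mono) auto
      finally have end_le: "N ((fdiff (2 powr (- real n) *\<^sub>R u) ^^ r) f) powr s
          \<le> 2 powr (real r * s) * \<omega> powr s" by simp
      have "m * (\<Sum>j=1..n. 2 powr (real j * real r * s) * g j u)
          \<le> m * (\<Sum>j=1..n. 2 powr (real j * real r * s) * g j u)
            + 2 powr (real r * s) * N ((fdiff u ^^ r) f) powr s"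
        by simp
      also have "\<dots> \<le> 2 powr (real (n + 1) * real r * s)
          * N ((fdiff (2 powr (- real n) *\<^sub>R u) ^^ r) f) powr s"
        unfolding g_def by (rule sum_fdiff_dyadic_le[OF f r])
      also have "\<dots> \<le> 2 powr (real (n + 1) * real r * s) * (2 powr (real r * s) * \<omega> powr s)"
        using end_le by (intro mult_left_mono) auto
      also have "2 powr (real (n + 1) * real r * s) = 2 powr (real n * real r * s) * 2 powr (real r * s)"
        by (simp add: powr_add[symmetric] algebra_simps)
      finally show ?thesis using m_pos by (simp add: M_def field_simps)
    qed
    have weighted: "set_integrable lborel (cball 0 2) (\<lambda>u. 2 powr (real j * real r * s) * g j u)" for j
      using int by simp
    have int_sum: "set_integrable lborel (cball 0 2) (\<lambda>u. \<Sum>j=1..n. 2 powr (real j * real r * s) * g j u)"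
      using weighted unfolding set_integrable_def scaleR_sum_right
      by (intro Bochner_Integration.integrable_sum)
    have "(\<Sum>j=1..n. 2 powr (real j * real r * s)
        * modulus_of_smoothness N (r + 1) f (2 powr (- real j)) powr s)
      \<le> (\<Sum>j=1..n. 2 powr (real j * real r * s) * (K * (LINT u:cball 0 2|lborel. g j u)))"
      by (intro sum_mono mult_left_mono modulus) simp
    also have "\<dots> = K * (LINT u:cball 0 2|lborel. \<Sum>j=1..n. 2 powr (real j * real r * s) * g j u)"
    proof -
      have "(LINT u:cball 0 2|lborel. \<Sum>j=1..n. 2 powr (real j * real r * s) * g j u)
          = (\<Sum>j=1..n. LINT u:cball 0 2|lborel. 2 powr (real j * real r * s) * g j u)"
        using weighted unfolding set_integrable_def set_lebesgue_integral_def scaleR_sum_right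
        by (intro Bochner_Integration.integral_sum)
      then show ?thesis by (simp add: sum_distrib_left mult_ac)
    qed
    also have "\<dots> \<le> K * (LINT u:cball (0::real^'d) 2|lborel. M)"
      using K sum_le int_sum emeasure_bounded_finite[of "cball (0::real^'d) 2"]
      by (intro mult_left_mono set_integral_mono) (auto simp: set_integrable_def)
    also have "(LINT u:cball (0::real^'d) 2|lborel. M) = V * M"
      by (simp add: set_lebesgue_integral_def V_def)
    finally show ?thesis by (simp add: C_def M_def \<omega>_def mult_ac)
  qed
  moreover have "0 < C" using K V m_pos by (simp add: C_def)
  ultimately show ?thesis by blast
qed

end

section \<open>The sharp Jackson-type inequality\<close>

theorem theorem1p1:
  fixes X B :: "(real^'d \<Rightarrow> 'c::real_normed_field) set"
    and N :: "(real^'d \<Rightarrow> 'c) \<Rightarrow> real"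
    and r :: nat and s m :: real
  assumes "1 \<le> r"
    and "X = UNIV \<or> X = torus_functions"
    and "banach_function_space X B N"
    and "2 \<le> s" and "0 < m"
    and "\<And>F G. \<lbrakk>F \<in> B; G \<in> B\<rbrakk> \<Longrightarrow>
           max (N (\<lambda>x. F x + G x)) (N (\<lambda>x. F x - G x))
             \<ge> (N F powr s + m * N G powr s) powr (1 / s)"
    and "\<And>f \<xi>. f \<in> B \<Longrightarrow> (\<lambda>x. f (x + \<xi>)) \<in> B \<and> N (\<lambda>x. f (x + \<xi>)) = N f"
    and "\<And>f. f \<in> B \<Longrightarrow> ((\<lambda>h. N (\<lambda>x. f (x + h) - f x)) \<longlongrightarrow> 0) (at 0)"
    and "\<And>f. f \<in> B \<Longrightarrow> (\<lambda>x. f (- x)) \<in> B \<and> N (\<lambda>x. f (- x)) = N f"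
  shows "\<exists>C>0. \<forall>f\<in>B. \<forall>n\<ge>1::nat.
           2 powr (- (real n * real r))
             * (\<Sum>j=1..n. 2 powr (real j * real r * s)
                  * modulus_of_smoothness N (r + 1) f (2 powr (- real j)) powr s) powr (1 / s)
           \<le> C * modulus_of_smoothness N r f (2 powr (- real n))"
proof -
  interpret banach_function_space X B N by (rule assms(3))
  interpret power_type_space X B N s m
    using assms by unfold_locales auto
  obtain C where C: "0 < C" and sum_le: "\<And>f n. f \<in> B \<Longrightarrow>
      (\<Sum>j=1..n. 2 powr (real j * real r * s)
        * modulus_of_smoothness N (r + 1) f (2 powr (- real j)) powr s)
      \<le> C * 2 powr (real n * real r * s) * modulus_of_smoothness N r f (2 powr (- real n)) powr s"
    using sum_modulus_dyadic_le[OF assms(1)] by blast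
  have "2 powr (- (real n * real r))
         * (\<Sum>j=1..n. 2 powr (real j * real r * s)
              * modulus_of_smoothness N (r + 1) f (2 powr (- real j)) powr s) powr (1 / s)
       \<le> C powr (1 / s) * modulus_of_smoothness N r f (2 powr (- real n))"
    if f: "f \<in> B" for f and n :: nat
  proof -
    let ?\<omega> = "modulus_of_smoothness N r f (2 powr (- real n))"
    have \<omega>: "0 \<le> ?\<omega>" by (rule modulus_nonneg[OF f]) simp
    have "(\<Sum>j=1..n. 2 powr (real j * real r * s)
          * modulus_of_smoothness N (r + 1) f (2 powr (- real j)) powr s) powr (1 / s)
        \<le> (C * 2 powr (real n * real r * s) * ?\<omega> powr s) powr (1 / s)"
      using s_pos by (intro powr_mono2 sum_le[OF f] sum_nonneg) auto
    also have "\<dots> = 2 powr (real n * real r) * (C powr (1 / s) * ?\<omega>)"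
      using s_pos C \<omega> by (simp add: powr_mult powr_powr)
    finally have "2 powr (- (real n * real r)) * (\<Sum>j=1..n. 2 powr (real j * real r * s)
          * modulus_of_smoothness N (r + 1) f (2 powr (- real j)) powr s) powr (1 / s)
        \<le> 2 powr (- (real n * real r)) * (2 powr (real n * real r) * (C powr (1 / s) * ?\<omega>))"
      by (intro mult_left_mono) auto
    also have "\<dots> = C powr (1 / s) * ?\<omega>"
      using powr_add[of 2 "- (real n * real r)" "real n * real r"] by simp
    finally show ?thesis .
  qed
  moreover have "0 < C powr (1 / s)" using C by simp
  ultimately show ?thesis by blast
qed

end
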